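(* Fix $\nu>0$. There exists a constant $C_\nu>0$ depending only on $\nu$, given for $\nu<1/2$ by $$C_\nu=\log\Big[(1+8\nu^2)\vee\log\Big(\frac{e}{2-4\nu}\Big)\Big],$$ such that for all positive integers $n,p,k$ with $k\le p$ and all $\theta>0$ satisfying $$\theta<\underline\theta_\nu:=\sqrt{\frac{k\log(C_\nu p/k^2+1)}{n}}\wedge\frac1{\sqrt2},$$ it holds $$\inf_{\psi}\Big\{\mathbf P_0^{n}(\psi=1)\vee\max_{v\in\mathcal B_0(k)}\mathbf P_v^{n}(\psi=0)\Big\}\ge\frac12-\nu,$$ where the infimum is taken over all possible tests, that is, measurable functions of the $n$ observations that take values in $\{0,1\}$.
   Context: $\mathcal B_0(k)=\{v\in\mathbb R^p:|v|_2=1,\ |v|_0\le k\}$, where $|v|_2$ is the Euclidean norm and $|v|_0$ the number of nonzero entries. $\mathbf P_0$ denotes the distribution $\mathcal N(0,I_p)$ on $\mathbb R^p$; for a unit vector $v\in\mathbb R^p$, $\mathbf P_v$ denotes the distribution $\mathcal N(0,I_p+\theta vv^\top)$. $\mathbf P^{n}$ denotes the joint distribution of $n$ i.i.d. random vectors with distribution $\mathbf P$. $a\wedge b=\min(a,b)$ and $a\vee b=\max(a,b)$. *)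

theory Defs
  imports
    "HOL-Probability.Probability"
    "Jordan_Normal_Form.Determinant"
    "Jordan_Normal_Form.Gauss_Jordan_Elimination"
begin

text \<open>
  The dimension \<open>p\<close> is quantified inside the theorem, so \<open>\<real>\<^sup>p\<close> is not a type here.
  As a sample space it is the product space of \<open>p\<close> copies of the Borel line (functions on
  \<open>{..<p}\<close>); for linear algebra, a point \<open>x\<close> of it is read as \<open>Matrix.vec p x\<close>.
\<close>

definition B0 :: "nat \<Rightarrow> nat \<Rightarrow> real Matrix.vec set" where
  "B0 p k = {v \<in> carrier_vec p.
     L2_set (\<lambda>i. vec_index v i) {..<p} = 1 \<and> card {i. i < p \<and> vec_index v i \<noteq> 0} \<le> k}"

text \<open>
  The centred normal distribution \<open>N(0, \<Sigma>)\<close> on \<open>\<real>\<^sup>p\<close>, by its Lebesgue density.  Only meaningful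
  for positive definite \<open>\<Sigma>\<close>; in particular \<open>mat_inverse \<Sigma>\<close> must not be \<open>None\<close>.
\<close>

definition gaussian :: "nat \<Rightarrow> real Matrix.mat \<Rightarrow> (nat \<Rightarrow> real) measure" where
  "gaussian p \<Sigma> = density (Pi\<^sub>M {..<p} (\<lambda>_. lborel))
     (\<lambda>x. ennreal
        (exp (- scalar_prod (Matrix.vec p x) (the (mat_inverse \<Sigma>) *\<^sub>v Matrix.vec p x) / 2)
         / sqrt ((2 * pi) ^ p * Determinant.det \<Sigma>)))"

definition outer :: "nat \<Rightarrow> real Matrix.vec \<Rightarrow> real Matrix.mat" where
  "outer p v = Matrix.mat p p (\<lambda>(i, j). vec_index v i * vec_index v j)"

definition P0 :: "nat \<Rightarrow> (nat \<Rightarrow> real) measure" where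
  "P0 p = gaussian p (1\<^sub>m p)"

definition Pv :: "nat \<Rightarrow> real \<Rightarrow> real Matrix.vec \<Rightarrow> (nat \<Rightarrow> real) measure" where
  "Pv p \<theta> v = gaussian p (1\<^sub>m p + \<theta> \<cdot>\<^sub>m outer p v)"

definition iid :: "nat \<Rightarrow> 'a measure \<Rightarrow> (nat \<Rightarrow> 'a) measure" where
  "iid n P = Pi\<^sub>M {..<n} (\<lambda>_. P)"

definition tests :: "nat \<Rightarrow> nat \<Rightarrow> ((nat \<Rightarrow> nat \<Rightarrow> real) \<Rightarrow> nat) set" where
  "tests n p = iid n (Pi\<^sub>M {..<p} (\<lambda>_. borel)) \<rightarrow>\<^sub>M count_space {0, 1}"

definition P_event :: "'a measure \<Rightarrow> ('a \<Rightarrow> bool) \<Rightarrow> real" where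
  "P_event P A = measure P {x \<in> space P. A x}"

definition threshold :: "real \<Rightarrow> nat \<Rightarrow> nat \<Rightarrow> nat \<Rightarrow> real" where
  "threshold C n p k =
     min (sqrt (real k * ln (C * real p / (real k)\<^sup>2 + 1) / real n)) (1 / sqrt 2)"

end

theory Submission
  imports Defs
begin

text \<open>
  Replace the worst alternative by the average over the \<open>k\<close>-sparse vectors
  \<open>v\<^sub>S = 1\<^sub>S / sqrt k\<close>, where \<open>S\<close> is a uniformly distributed \<open>k\<close>-subset of the coordinates.  The likelihood
  ratio of \<open>N(0, I + \<theta> v v\<^sup>T)\<close> against \<open>N(0, I)\<close> is \<open>exp (c (v \<bullet> x)\<^sup>2 / 2) / sqrt (1 + \<theta>)\<close> with
  \<open>c = \<theta> / (1 + \<theta>)\<close>, and its Gaussian expectations reduce to one-dimensional integrals because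
  \<open>exp (c s\<^sup>2 / 2)\<close> is the expectation of \<open>exp (sqrt c * s * g)\<close> over a standard normal \<open>g\<close>.  Hence the
  averaged likelihood ratio \<open>L\<close> of the sample has second moment
  \<open>E (1 - \<theta>\<^sup>2 R\<^sup>2 / k\<^sup>2) powr (- n / 2)\<close> with \<open>R = card (S \<inter> T)\<close>, which the threshold on \<open>\<theta>\<close> bounds by
  \<open>E (1 + C p / k\<^sup>2) ^ R \<le> (1 + C / k) ^ k \<le> exp C\<close>.  A second moment \<open>K\<close> of \<open>L\<close> forces the
  larger error of every test to be at least \<open>1 / (4 K)\<close>, and at least \<open>1 / 2 - \<nu>\<close> if
  \<open>K \<le> 1 + 8 \<nu>\<^sup>2\<close>; these two bounds are the two entries of the maximum that defines \<open>C\<close>.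
\<close>

section \<open>Rank-one updates of the identity matrix\<close>

text \<open>Sylvester's identity: the block matrix with identity diagonal blocks and off-diagonal
  blocks \<open>B\<close> and \<open>C\<close> factors both as \<open>?L * ?U\<close> and as
  \<open>?V * ?L\<close>. Since \<open>?L\<close> has determinant 1, \<open>?U\<close> and
  \<open>?V\<close> have equal determinants.\<close>

lemma det_one_minus_mult_commute:
  fixes B C :: "'a :: idom mat"
  assumes B: "B \<in> carrier_mat p q" and C: "C \<in> carrier_mat q p"
  shows "Determinant.det (1\<^sub>m p - B * C) = Determinant.det (1\<^sub>m q - C * B)"
proof -
  let ?L = "four_block_mat (1\<^sub>m p) (0\<^sub>m p q) C (1\<^sub>m q)"
  let ?U = "four_block_mat (1\<^sub>m p) B (0\<^sub>m q p) (1\<^sub>m q - C * B)"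
  let ?V = "four_block_mat (1\<^sub>m p - B * C) B (0\<^sub>m q p) (1\<^sub>m q)"
  have BC: "B * C \<in> carrier_mat p p" and CB: "C * B \<in> carrier_mat q q" using B C by auto
  have "1\<^sub>m n - X + X = 1\<^sub>m n" "X + (1\<^sub>m n - X) = 1\<^sub>m n" if "X \<in> carrier_mat n n" for X :: "'a mat" and n
    using that by (auto intro!: eq_matI)
  note p0 = this(1)[OF BC] and q0 = this(2)[OF CB]
  have "?L * ?U = four_block_mat (1\<^sub>m p) B C (1\<^sub>m q)"
    by (subst mult_four_block_mat[of _ p p _ q _ q _ _ p _ q]) (use B C BC CB p0 q0 in auto)
  moreover have "?V * ?L = four_block_mat (1\<^sub>m p) B C (1\<^sub>m q)"
    by (subst mult_four_block_mat[of _ p p _ q _ q _ _ p _ q]) (use B C BC CB p0 q0 in auto)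
  ultimately have "Determinant.det (?V * ?L) = Determinant.det (?L * ?U)" by simp
  moreover have "Determinant.det (?V * ?L) = Determinant.det ?V * Determinant.det ?L"
    using B C BC CB by (intro det_mult[of _ "p + q"]) auto
  moreover have "Determinant.det (?L * ?U) = Determinant.det ?L * Determinant.det ?U"
    using B C BC CB by (intro det_mult[of _ "p + q"]) auto
  moreover have "Determinant.det ?L = 1"
    by (subst det_four_block_mat_upper_right_zero[of _ p _ q]) (use B C in auto)
  moreover have "Determinant.det ?U = Determinant.det (1\<^sub>m q - C * B)"
    by (subst det_four_block_mat_lower_left_zero[of _ p _ q]) (use B C in auto)
  moreover have "Determinant.det ?V = Determinant.det (1\<^sub>m p - B * C)"
    by (subst det_four_block_mat_lower_left_zero[of _ p _ q]) (use B C in auto)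
  ultimately show ?thesis by simp
qed

text \<open>Writing the update as \<open>1 - B * C\<close> with a column \<open>B\<close> and a row
  \<open>C\<close>, Sylvester's identity leaves a 1 by 1 determinant.\<close>

lemma det_rank_one_update:
  "Determinant.det (1\<^sub>m p + \<theta> \<cdot>\<^sub>m outer p v) = 1 + \<theta> * (\<Sum>i<p. (vec_index v i)\<^sup>2)"
proof -
  let ?B = "Matrix.mat p 1 (\<lambda>(i, j). - \<theta> * vec_index v i)"
  let ?C = "Matrix.mat 1 p (\<lambda>(i, j). vec_index v j)"
  have 1: "1\<^sub>m p + \<theta> \<cdot>\<^sub>m outer p v = 1\<^sub>m p - ?B * ?C"
    by (rule eq_matI) (auto simp: outer_def scalar_prod_def)
  have 2: "(1\<^sub>m 1 - ?C * ?B) $$ (0, 0) = 1 + \<theta> * (\<Sum>i<p. (vec_index v i)\<^sup>2)"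
    by (simp add: scalar_prod_def power2_eq_square sum_distrib_left sum_negf atLeast0LessThan algebra_simps)
  show ?thesis
    unfolding 1 2[symmetric]
    by (subst det_one_minus_mult_commute[of _ p 1], simp, simp, rule det_single)
      (intro minus_carrier_mat mult_carrier_mat[of _ _ p], simp_all)
qed

text \<open>This evaluates \<open>the (mat_inverse \<Sigma>)\<close> in \<open>gaussian\<close>: a
  one-sided inverse of a square matrix is two-sided, so \<open>mat_inverse\<close> succeeds, and
  inverses are unique.\<close>

lemma mat_inverse_eq_SomeI:
  fixes A B :: "'a :: field mat"
  assumes A: "A \<in> carrier_mat n n" and B: "B \<in> carrier_mat n n" and AB: "A * B = 1\<^sub>m n"
  shows "mat_inverse A = Some B"
proof -
  have BA: "B * A = 1\<^sub>m n" using mat_mult_left_right_inverse[OF A B AB] .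
  have "A \<in> Units (ring_mat TYPE('a) n undefined)"
    using A B AB BA by (auto simp: Units_def ring_mat_def)
  then obtain B' where B': "mat_inverse A = Some B'"
    using mat_inverse(1)[OF A] by (metis option.exhaust)
  have "B' * A = 1\<^sub>m n" "B' \<in> carrier_mat n n" using mat_inverse(2)[OF A B'] by auto
  then have "B' = B' * (A * B)" using AB by simp
  also have "\<dots> = B" using A B \<open>B' * A = 1\<^sub>m n\<close> \<open>B' \<in> carrier_mat n n\<close>
    by (simp flip: assoc_mult_mat)
  finally show ?thesis using B' by simp
qed

text \<open>Sherman-Morrison: the outer product of a unit vector is idempotent, so the two matrices
  multiply to the identity plus \<open>c + \<theta> + \<theta> * c\<close> times the outer product,
  and this coefficient vanishes for \<open>c = - (\<theta> / (1 + \<theta>))\<close>.\<close>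

lemma mat_inverse_rank_one_update:
  fixes \<theta> :: real
  assumes "1 + \<theta> \<noteq> 0" and v: "(\<Sum>i<p. (vec_index v i)\<^sup>2) = 1"
  shows "mat_inverse (1\<^sub>m p + \<theta> \<cdot>\<^sub>m outer p v) = Some (1\<^sub>m p + (- (\<theta> / (1 + \<theta>))) \<cdot>\<^sub>m outer p v)"
proof (rule mat_inverse_eq_SomeI[of _ p])
  define c where "c = - (\<theta> / (1 + \<theta>))"
  have O: "outer p v \<in> carrier_mat p p" by (simp add: outer_def)
  have OO: "outer p v * outer p v = outer p v"
  proof (rule eq_matI)
    fix i j assume "i < dim_row (outer p v)" "j < dim_col (outer p v)"
    then have ij: "i < p" "j < p" by (auto simp: outer_def)
    have "(\<Sum>l<p. vec_index v i * vec_index v l * (vec_index v l * vec_index v j))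
        = vec_index v i * vec_index v j * (\<Sum>l<p. (vec_index v l)\<^sup>2)"
      by (simp add: sum_distrib_left power2_eq_square ac_simps)
    then show "(outer p v * outer p v) $$ (i, j) = outer p v $$ (i, j)"
      using ij v by (simp add: outer_def scalar_prod_def atLeast0LessThan)
  qed (auto simp: outer_def)
  have c: "c + \<theta> + \<theta> * c = 0" using assms(1) by (simp add: c_def field_simps)
  have "(1\<^sub>m p + \<theta> \<cdot>\<^sub>m outer p v) * (1\<^sub>m p + c \<cdot>\<^sub>m outer p v)
      = 1\<^sub>m p * (1\<^sub>m p + c \<cdot>\<^sub>m outer p v) + (\<theta> \<cdot>\<^sub>m outer p v) * (1\<^sub>m p + c \<cdot>\<^sub>m outer p v)"
    using O by (intro add_mult_distrib_mat) auto
  also have "(\<theta> \<cdot>\<^sub>m outer p v) * (1\<^sub>m p + c \<cdot>\<^sub>m outer p v)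
      = (\<theta> \<cdot>\<^sub>m outer p v) * 1\<^sub>m p + (\<theta> \<cdot>\<^sub>m outer p v) * (c \<cdot>\<^sub>m outer p v)"
    using O by (intro mult_add_distrib_mat) auto
  also have "(\<theta> \<cdot>\<^sub>m outer p v) * (c \<cdot>\<^sub>m outer p v) = (\<theta> * c) \<cdot>\<^sub>m outer p v"
    using O by (simp add: mult_smult_assoc_mat[OF O O] mult_smult_distrib[of _ p p _ p] OO) (auto intro!: eq_matI)
  also have "1\<^sub>m p * (1\<^sub>m p + c \<cdot>\<^sub>m outer p v) + ((\<theta> \<cdot>\<^sub>m outer p v) * 1\<^sub>m p + (\<theta> * c) \<cdot>\<^sub>m outer p v)
     = 1\<^sub>m p + (c + \<theta> + \<theta> * c) \<cdot>\<^sub>m outer p v"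
    using O by (intro eq_matI) (auto simp: algebra_simps)
  also have "\<dots> = 1\<^sub>m p" unfolding c using O by (intro eq_matI) auto
  finally show "(1\<^sub>m p + \<theta> \<cdot>\<^sub>m outer p v) * (1\<^sub>m p + (- (\<theta> / (1 + \<theta>))) \<cdot>\<^sub>m outer p v) = 1\<^sub>m p"
    by (simp add: c_def)
qed (auto simp: outer_def)

lemma quadratic_form_rank_one_update:
  "scalar_prod (Matrix.vec p x) ((1\<^sub>m p + c \<cdot>\<^sub>m outer p v) *\<^sub>v Matrix.vec p x)
    = (\<Sum>i<p. (x i)\<^sup>2) + c * (\<Sum>i<p. vec_index v i * x i)\<^sup>2"
proof -
  have O: "outer p v *\<^sub>v Matrix.vec p x
      = (\<Sum>j<p. vec_index v j * x j) \<cdot>\<^sub>v Matrix.vec p (\<lambda>i. vec_index v i)"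
    by (rule eq_vecI)
      (auto simp: outer_def scalar_prod_def sum_distrib_left sum_distrib_right atLeast0LessThan ac_simps)
  have "(1\<^sub>m p + c \<cdot>\<^sub>m outer p v) *\<^sub>v Matrix.vec p x
      = 1\<^sub>m p *\<^sub>v Matrix.vec p x + (c \<cdot>\<^sub>m outer p v) *\<^sub>v Matrix.vec p x"
    by (rule add_mult_distrib_mat_vec[of _ p p]) (auto simp: outer_def)
  also have "(c \<cdot>\<^sub>m outer p v) *\<^sub>v Matrix.vec p x = c \<cdot>\<^sub>v (outer p v *\<^sub>v Matrix.vec p x)"
    by (rule eq_vecI) (auto simp: outer_def scalar_prod_def sum_distrib_left ac_simps)
  finally show ?thesis
    unfolding O by (simp add: scalar_prod_def atLeast0LessThan power2_eq_square algebra_simps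
        sum.distrib sum_distrib_left sum_distrib_right)
qed

section \<open>Gaussian integrals\<close>

text \<open>A finite product measure is determined by its values on boxes, where the integral
  factors over the coordinates. This serves twice: for the coordinates of a normal vector and for
  the observations of a sample.\<close>

lemma density_PiM:
  fixes M :: "'a measure"
  assumes "finite I" and f: "f \<in> borel_measurable M"
    and M: "sigma_finite_measure M" and D: "sigma_finite_measure (density M f)"
  shows "PiM I (\<lambda>_. density M f) = density (PiM I (\<lambda>_. M)) (\<lambda>x. \<Prod>i\<in>I. f (x i))"
proof -
  interpret M: sigma_finite_measure M by fact
  interpret D: sigma_finite_measure "density M f" by fact
  interpret PM: product_sigma_finite "\<lambda>_. M" ..
  interpret PD: product_sigma_finite "\<lambda>_. density M f" ..
  have [measurable]: "(\<lambda>x. \<Prod>i\<in>I. f (x i)) \<in> borel_measurable (PiM I (\<lambda>_. M))"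
    using f by measurable
  show ?thesis
  proof (rule PD.PiM_eqI[symmetric])
    show "sets (density (PiM I (\<lambda>_. M)) (\<lambda>x. \<Prod>i\<in>I. f (x i))) = sets (PiM I (\<lambda>_. density M f))"
      by (simp cong: sets_PiM_cong)
    fix A assume "\<And>i. i \<in> I \<Longrightarrow> A i \<in> sets (density M f)"
    then have A: "A i \<in> sets M" if "i \<in> I" for i using that by simp
    then have [measurable]: "Pi\<^sub>E I A \<in> sets (PiM I (\<lambda>_. M))"
      using \<open>finite I\<close> by (intro sets_PiM_I_finite) auto
    have "emeasure (density (PiM I (\<lambda>_. M)) (\<lambda>x. \<Prod>i\<in>I. f (x i))) (Pi\<^sub>E I A)
        = (\<integral>\<^sup>+x. (\<Prod>i\<in>I. f (x i)) * indicator (Pi\<^sub>E I A) x \<partial>PiM I (\<lambda>_. M))"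
      by (simp add: emeasure_density)
    also have "\<dots> = (\<integral>\<^sup>+x. (\<Prod>i\<in>I. f (x i) * indicator (A i) (x i)) \<partial>PiM I (\<lambda>_. M))"
    proof (rule nn_integral_cong)
      fix x assume "x \<in> space (PiM I (\<lambda>_. M))"
      \<comment> \<open>Points of the product space are extensional, so a point outside the box must
        fail in some coordinate of \<open>I\<close>.\<close>
      then have x: "x \<in> extensional I" by (simp add: space_PiM PiE_def)
      have "(indicator (Pi\<^sub>E I A) x :: ennreal) = (\<Prod>i\<in>I. indicator (A i) (x i))"
      proof (cases "x \<in> Pi\<^sub>E I A")
        case False
        then obtain i where "i \<in> I" "x i \<notin> A i" using x by (auto simp: PiE_def)
        then show ?thesis using False \<open>finite I\<close> by (auto simp: prod_zero_iff indicator_def)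
      qed (auto simp: PiE_def Pi_def)
      then show "(\<Prod>i\<in>I. f (x i)) * indicator (Pi\<^sub>E I A) x = (\<Prod>i\<in>I. f (x i) * indicator (A i) (x i))"
        by (simp add: prod.distrib)
    qed
    also have "\<dots> = (\<Prod>i\<in>I. \<integral>\<^sup>+x. f x * indicator (A i) x \<partial>M)"
      using f A \<open>finite I\<close> by (intro PM.product_nn_integral_prod) auto
    also have "\<dots> = (\<Prod>i\<in>I. emeasure (density M f) (A i))"
      using f A by (intro prod.cong) (auto simp: emeasure_density)
    finally show "emeasure (density (PiM I (\<lambda>_. M)) (\<lambda>x. \<Prod>i\<in>I. f (x i))) (Pi\<^sub>E I A)
        = (\<Prod>i\<in>I. emeasure (density M f) (A i))" .
  qed fact
qed

section \<open>Exponential moments of linear and squared linear forms\<close>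

abbreviation std_normal :: "real measure" where
  "std_normal \<equiv> density lborel std_normal_density"

text \<open>Completing the square turns the integrand into a constant times the normal density of
  mean \<open>b / (1 - c)\<close> and variance \<open>1 / (1 - c)\<close>.\<close>

lemma nn_integral_std_normal_exp:
  assumes "c < 1"
  shows "(\<integral>\<^sup>+x. ennreal (exp (c * x\<^sup>2 / 2 + b * x)) \<partial>std_normal)
    = ennreal (exp (b\<^sup>2 / (2 * (1 - c))) / sqrt (1 - c))"
proof -
  define K where "K = exp (b\<^sup>2 / (2 * (1 - c))) / sqrt (1 - c)"
  have K: "K \<ge> 0" using assms by (simp add: K_def)
  have *: "std_normal_density x * exp (c * x\<^sup>2 / 2 + b * x)
      = K * normal_density (b / (1 - c)) (1 / sqrt (1 - c)) x" for x
  proof -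
    define a where "a = 1 - c"
    have a: "a > 0" and c: "c = 1 - a" using assms by (auto simp: a_def)
    have e: "- x\<^sup>2 / 2 + (c * x\<^sup>2 / 2 + b * x) = b\<^sup>2 / (2 * a) + - (x - b / a)\<^sup>2 / (2 * (1 / a))"
      using a by (simp add: c field_simps power2_eq_square)
    have "std_normal_density x * exp (c * x\<^sup>2 / 2 + b * x)
      = 1 / sqrt (2 * pi) * exp (- x\<^sup>2 / 2 + (c * x\<^sup>2 / 2 + b * x))"
      unfolding std_normal_density_def exp_add by simp
    also have "\<dots> = K * normal_density (b / a) (1 / sqrt a) x"
      unfolding e exp_add K_def a_def[symmetric] normal_density_def
      using a by (simp add: power_divide real_sqrt_divide)
    finally show ?thesis by (simp add: a_def)
  qed
  have "(\<integral>\<^sup>+x. ennreal (exp (c * x\<^sup>2 / 2 + b * x)) \<partial>std_normal)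
      = (\<integral>\<^sup>+x. ennreal K * ennreal (normal_density (b / (1 - c)) (1 / sqrt (1 - c)) x) \<partial>lborel)"
    by (subst nn_integral_density) (auto simp: ennreal_mult'[symmetric] * K)
  also have "\<dots> = ennreal K * 1"
    using assms by (subst nn_integral_cmult) (auto simp: nn_integral_eq_integral)
  finally show ?thesis by (simp add: K_def)
qed

lemma prob_space_std_normal: "prob_space std_normal"
  using prob_space_normal_density[of 1 0] by simp

lemma sets_PiM_std_normal [measurable_cong]:
  "sets (PiM I (\<lambda>_. std_normal)) = sets (PiM I (\<lambda>_. borel))"
  by (intro sets_PiM_cong) auto

lemma nn_integral_PiM_std_normal_exp:
  assumes I: "finite I"
  shows "(\<integral>\<^sup>+x. ennreal (exp (\<Sum>i\<in>I. w i * x i)) \<partial>PiM I (\<lambda>_. std_normal))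
    = ennreal (exp ((\<Sum>i\<in>I. (w i)\<^sup>2) / 2))"
proof -
  interpret prob_space std_normal by (rule prob_space_std_normal)
  interpret product_sigma_finite "\<lambda>_. std_normal" ..
  have "(\<integral>\<^sup>+x. ennreal (exp (\<Sum>i\<in>I. w i * x i)) \<partial>PiM I (\<lambda>_. std_normal))
      = (\<integral>\<^sup>+x. (\<Prod>i\<in>I. ennreal (exp (w i * x i))) \<partial>PiM I (\<lambda>_. std_normal))"
    using I by (simp add: exp_sum prod_ennreal)
  also have "\<dots> = (\<Prod>i\<in>I. \<integral>\<^sup>+x. ennreal (exp (w i * x)) \<partial>std_normal)"
    using I by (intro product_nn_integral_prod) auto
  also have "\<dots> = (\<Prod>i\<in>I. ennreal (exp ((w i)\<^sup>2 / 2)))"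
    using nn_integral_std_normal_exp[of 0] by simp
  also have "\<dots> = ennreal (exp (\<Sum>i\<in>I. (w i)\<^sup>2 / 2))"
    using I by (simp add: exp_sum prod_ennreal)
  finally show ?thesis by (simp add: sum_divide_distrib)
qed

text \<open>The moment generating function read backwards: an auxiliary variable \<open>g\<close>
  trades the square for a linear exponent, under which the coordinates of a product space
  separate.\<close>

lemma exp_square_linearise:
  assumes "c \<ge> 0"
  shows "ennreal (exp (c * s\<^sup>2 / 2)) = (\<integral>\<^sup>+g. ennreal (exp (sqrt c * s * g)) \<partial>std_normal)"
  using nn_integral_std_normal_exp[of 0 "sqrt c * s"] assms by (simp add: power_mult_distrib)

text \<open>After linearising and exchanging the integrals, the inner one depends only on the
  squared norm of the weights \<open>sqrt c * g * u i\<close>, which is \<open>c * g^2\<close> for a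
  unit vector; one Gaussian integral in \<open>g\<close> is left.\<close>

lemma nn_integral_PiM_std_normal_exp_square:
  fixes u :: "'i \<Rightarrow> real"
  assumes I: "finite I" and u: "(\<Sum>i\<in>I. (u i)\<^sup>2) = 1" and c: "0 \<le> c" "c < 1"
  shows "(\<integral>\<^sup>+x. ennreal (exp (c * (\<Sum>i\<in>I. u i * x i)\<^sup>2 / 2)) \<partial>PiM I (\<lambda>_. std_normal))
    = ennreal (1 / sqrt (1 - c))" (is "integral\<^sup>N ?P _ = _")
proof -
  interpret N: prob_space std_normal by (rule prob_space_std_normal)
  interpret P: prob_space ?P by (intro prob_space_PiM prob_space_std_normal)
  interpret pair_sigma_finite std_normal ?P ..
  have "integral\<^sup>N ?P (\<lambda>x. ennreal (exp (c * (\<Sum>i\<in>I. u i * x i)\<^sup>2 / 2)))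
      = (\<integral>\<^sup>+x. (\<integral>\<^sup>+g. ennreal (exp (sqrt c * (\<Sum>i\<in>I. u i * x i) * g)) \<partial>std_normal) \<partial>?P)"
    using c by (simp add: exp_square_linearise)
  also have "\<dots> = (\<integral>\<^sup>+g. (\<integral>\<^sup>+x. ennreal (exp (sqrt c * (\<Sum>i\<in>I. u i * x i) * g)) \<partial>?P) \<partial>std_normal)"
    by (rule Fubini') measurable
  also have "\<dots> = (\<integral>\<^sup>+g. ennreal (exp (c * g\<^sup>2 / 2 + 0 * g)) \<partial>std_normal)"
  proof (rule nn_integral_cong)
    fix g :: real
    have "sqrt c * (\<Sum>i\<in>I. u i * x i) * g = (\<Sum>i\<in>I. (sqrt c * g * u i) * x i)" for x
      by (simp add: sum_distrib_left sum_distrib_right ac_simps)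
    moreover have "(\<Sum>i\<in>I. (sqrt c * g * u i)\<^sup>2) = c * g\<^sup>2"
      using u c by (simp add: power_mult_distrib flip: sum_distrib_left)
    ultimately show "(\<integral>\<^sup>+x. ennreal (exp (sqrt c * (\<Sum>i\<in>I. u i * x i) * g)) \<partial>?P)
      = ennreal (exp (c * g\<^sup>2 / 2 + 0 * g))"
      using nn_integral_PiM_std_normal_exp[OF I, of "\<lambda>i. sqrt c * g * u i"] by simp
  qed
  also have "\<dots> = ennreal (1 / sqrt (1 - c))"
    by (subst nn_integral_std_normal_exp) (use c in auto)
  finally show ?thesis .
qed

text \<open>Both squares are linearised, by \<open>g\<close> and \<open>h\<close>; integrating out
  \<open>x\<close> leaves a quadratic form in the two, coupled only through
  \<open>c * r * g * h\<close>. The value is the inverse root of the determinant of the 2 by 2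
  matrix with diagonal \<open>1 - c\<close> and off-diagonal \<open>- c * r\<close>, which is
  positive definite by the assumption on \<open>c * \<bar>r\<bar>\<close>.\<close>

lemma nn_integral_PiM_std_normal_exp_square2:
  fixes u v :: "'i \<Rightarrow> real"
  assumes I: "finite I" and u: "(\<Sum>i\<in>I. (u i)\<^sup>2) = 1" and v: "(\<Sum>i\<in>I. (v i)\<^sup>2) = 1"
    and c: "0 \<le> c" "c < 1" and r: "(\<Sum>i\<in>I. u i * v i) = r" "c * \<bar>r\<bar> < 1 - c"
  shows "(\<integral>\<^sup>+x. ennreal (exp (c * (\<Sum>i\<in>I. u i * x i)\<^sup>2 / 2) * exp (c * (\<Sum>i\<in>I. v i * x i)\<^sup>2 / 2))
      \<partial>PiM I (\<lambda>_. std_normal))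
    = ennreal (1 / sqrt ((1 - c)\<^sup>2 - (c * r)\<^sup>2))" (is "integral\<^sup>N ?P _ = _")
proof -
  interpret N: prob_space std_normal by (rule prob_space_std_normal)
  interpret P: prob_space ?P by (intro prob_space_PiM prob_space_std_normal)
  interpret pair_sigma_finite std_normal ?P ..
  define su sv where "su = (\<lambda>x. \<Sum>i\<in>I. u i * x i)" and "sv = (\<lambda>x. \<Sum>i\<in>I. v i * x i)"
  have [measurable]: "su \<in> borel_measurable ?P" "sv \<in> borel_measurable ?P"
    unfolding su_def sv_def by measurable
  \<comment> \<open>The coefficient of \<open>g^2 / 2\<close> once \<open>h\<close> is integrated
    out: completing the square in \<open>h\<close> adds \<open>(c * r * g)^2 / (2 * (1 - c))\<close>
    to \<open>c * g^2 / 2\<close>.\<close>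
  define d where "d = c + (c * r)\<^sup>2 / (1 - c)"
  have "(c * \<bar>r\<bar>)\<^sup>2 < (1 - c)\<^sup>2" using r c by (intro power_strict_mono) auto
  then have r2: "(c * r)\<^sup>2 < (1 - c)\<^sup>2" by (simp add: power_mult_distrib)
  then have "(c * r)\<^sup>2 / (1 - c) < 1 - c" using c by (simp add: field_simps power2_eq_square)
  then have d: "d < 1" by (simp add: d_def)
  have inner: "(\<integral>\<^sup>+x. ennreal (exp (sqrt c * su x * g)) * ennreal (exp (c * (sv x)\<^sup>2 / 2)) \<partial>?P)
     = ennreal (exp (d * g\<^sup>2 / 2 + 0 * g)) * ennreal (1 / sqrt (1 - c))" for g
  proof -
    have "(\<integral>\<^sup>+x. ennreal (exp (sqrt c * su x * g)) * ennreal (exp (c * (sv x)\<^sup>2 / 2)) \<partial>?P)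
      = (\<integral>\<^sup>+x. (\<integral>\<^sup>+h. ennreal (exp (sqrt c * su x * g)) * ennreal (exp (sqrt c * sv x * h)) \<partial>std_normal) \<partial>?P)"
      using c by (subst nn_integral_cmult) (auto simp: exp_square_linearise)
    also have "\<dots> = (\<integral>\<^sup>+h. (\<integral>\<^sup>+x. ennreal (exp (sqrt c * su x * g)) * ennreal (exp (sqrt c * sv x * h)) \<partial>?P) \<partial>std_normal)"
      by (rule Fubini') measurable
    also have "\<dots> = (\<integral>\<^sup>+h. ennreal (exp (c * g\<^sup>2 / 2)) * ennreal (exp (c * h\<^sup>2 / 2 + c * r * g * h)) \<partial>std_normal)"
    proof (rule nn_integral_cong)
      fix h :: real
      have "sqrt c * su x * g + sqrt c * sv x * h = (\<Sum>i\<in>I. (sqrt c * (g * u i + h * v i)) * x i)" for x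
        by (simp add: su_def sv_def sum_distrib_left sum_distrib_right algebra_simps sum.distrib)
      moreover have "(\<Sum>i\<in>I. (sqrt c * (g * u i + h * v i))\<^sup>2) / 2 = c * g\<^sup>2 / 2 + (c * h\<^sup>2 / 2 + c * r * g * h)"
      proof -
        have "(\<Sum>i\<in>I. (sqrt c * (g * u i + h * v i))\<^sup>2)
          = c * (g\<^sup>2 * (\<Sum>i\<in>I. (u i)\<^sup>2) + h\<^sup>2 * (\<Sum>i\<in>I. (v i)\<^sup>2) + 2 * g * h * (\<Sum>i\<in>I. u i * v i))"
          using c by (subst power_mult_distrib)
            (simp add: power2_sum sum_distrib_left sum.distrib power_mult_distrib distrib_left ac_simps)
        then show ?thesis using u v r by (simp add: algebra_simps)
      qed
      ultimately show "(\<integral>\<^sup>+x. ennreal (exp (sqrt c * su x * g)) * ennreal (exp (sqrt c * sv x * h)) \<partial>?P)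
        = ennreal (exp (c * g\<^sup>2 / 2)) * ennreal (exp (c * h\<^sup>2 / 2 + c * r * g * h))"
        using nn_integral_PiM_std_normal_exp[OF I, of "\<lambda>i. sqrt c * (g * u i + h * v i)"]
        by (simp add: ennreal_mult'[symmetric] flip: exp_add)
    qed
    also have "\<dots> = ennreal (exp (c * g\<^sup>2 / 2)) * ennreal (exp ((c * r * g)\<^sup>2 / (2 * (1 - c))) / sqrt (1 - c))"
      by (subst nn_integral_cmult, measurable, subst nn_integral_std_normal_exp) (use c in auto)
    also have "\<dots> = ennreal (exp (d * g\<^sup>2 / 2 + 0 * g)) * ennreal (1 / sqrt (1 - c))"
    proof -
      have "d * g\<^sup>2 / 2 = c * g\<^sup>2 / 2 + (c * r * g)\<^sup>2 / (2 * (1 - c))"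
        using c by (simp add: d_def field_simps power_mult_distrib)
      then have "exp (d * g\<^sup>2 / 2) = exp (c * g\<^sup>2 / 2) * exp ((c * r * g)\<^sup>2 / (2 * (1 - c)))"
        by (simp only: exp_add)
      then show ?thesis using c by (simp add: ennreal_mult'[symmetric])
    qed
    finally show ?thesis .
  qed
  have "integral\<^sup>N ?P (\<lambda>x. ennreal (exp (c * (su x)\<^sup>2 / 2) * exp (c * (sv x)\<^sup>2 / 2)))
      = (\<integral>\<^sup>+x. (\<integral>\<^sup>+g. ennreal (exp (sqrt c * su x * g)) * ennreal (exp (c * (sv x)\<^sup>2 / 2)) \<partial>std_normal) \<partial>?P)"
    using c by (subst nn_integral_multc) (auto simp: exp_square_linearise[symmetric] ennreal_mult')
  also have "\<dots> = (\<integral>\<^sup>+g. (\<integral>\<^sup>+x. ennreal (exp (sqrt c * su x * g)) * ennreal (exp (c * (sv x)\<^sup>2 / 2)) \<partial>?P) \<partial>std_normal)"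
    by (rule Fubini') measurable
  also have "\<dots> = (\<integral>\<^sup>+g. ennreal (exp (d * g\<^sup>2 / 2 + 0 * g)) \<partial>std_normal) * ennreal (1 / sqrt (1 - c))"
    unfolding inner by (subst nn_integral_multc) auto
  also have "\<dots> = ennreal (1 / sqrt (1 - d)) * ennreal (1 / sqrt (1 - c))"
    by (subst nn_integral_std_normal_exp) (use d in auto)
  also have "\<dots> = ennreal (1 / sqrt ((1 - d) * (1 - c)))"
    using d c by (simp add: ennreal_mult'[symmetric] real_sqrt_mult)
  also have "(1 - d) * (1 - c) = (1 - c)\<^sup>2 - (c * r)\<^sup>2"
    using c by (simp add: d_def field_simps power2_eq_square)
  finally show ?thesis by (simp add: su_def sv_def)
qed

section \<open>Overlap of random subsets and testing against a mixture\<close>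

text \<open>Removing \<open>U\<close> from \<open>T\<close> is a bijection onto the subsets of
  \<open>A - U\<close> with \<open>k - card U\<close> elements.\<close>

lemma card_supersets_of_card:
  assumes A: "finite A" and U: "U \<subseteq> A" "card U \<le> k"
  shows "card {T. T \<subseteq> A \<and> card T = k \<and> U \<subseteq> T} = (card A - card U) choose (k - card U)"
proof -
  have fU: "finite U" using A U finite_subset by blast
  have "bij_betw (\<lambda>W. W \<union> U) {W. W \<subseteq> A - U \<and> card W = k - card U}
      {T. T \<subseteq> A \<and> card T = k \<and> U \<subseteq> T}"
  proof (rule bij_betw_byWitness[where f' = "\<lambda>T. T - U"])
    show "(\<lambda>W. W \<union> U) ` {W. W \<subseteq> A - U \<and> card W = k - card U}
        \<subseteq> {T. T \<subseteq> A \<and> card T = k \<and> U \<subseteq> T}"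
    proof safe
      fix W assume W: "W \<subseteq> A - U" "card W = k - card U"
      then have "finite W" "W \<inter> U = {}" using A finite_subset by blast+
      then show "card (W \<union> U) = k" using W U fU by (simp add: card_Un_disjoint)
    qed (use U in auto)
    show "(\<lambda>T. T - U) ` {T. T \<subseteq> A \<and> card T = k \<and> U \<subseteq> T}
        \<subseteq> {W. W \<subseteq> A - U \<and> card W = k - card U}"
      using fU by (auto simp: card_Diff_subset)
  qed auto
  then have "card {T. T \<subseteq> A \<and> card T = k \<and> U \<subseteq> T}
      = card {W. W \<subseteq> A - U \<and> card W = k - card U}"
    by (simp add: bij_betw_same_card)
  also have "\<dots> = card (A - U) choose (k - card U)"
    using A by (intro n_subsets) auto
  finally show ?thesis using A U fU by (simp add: card_Diff_subset)
qed

text \<open>Raising \<open>j\<close> by one multiplies the binomial coefficient by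
  \<open>(k - j) / (p - j)\<close>, which is at most \<open>k / p\<close>. In other words, a random
  \<open>k\<close>-subset contains a given \<open>j\<close>-set with probability at most
  \<open>(k / p) ^ j\<close>.\<close>

lemma choose_diff_le:
  assumes "j \<le> k" "k \<le> p"
  shows "real ((p - j) choose (k - j)) \<le> (real k / real p) ^ j * real (p choose k)"
  using assms(1)
proof (induction j)
  case (Suc j)
  obtain p' k' where p': "p - j = Suc p'" and k': "k - j = Suc k'"
    using Suc.prems assms(2) by (metis Suc_diff_Suc Suc_le_lessD order_less_le_trans)
  have "real (Suc k') * real (Suc p' choose Suc k') = real (Suc p') * real (p' choose k')"
    using Suc_times_binomial_eq[of p' k'] by (metis of_nat_mult mult.commute)
  then have "real (p' choose k') = real (k - j) / real (p - j) * real ((p - j) choose (k - j))"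
    unfolding p' k' by (simp add: field_simps)
  also have "\<dots> \<le> real k / real p * ((real k / real p) ^ j * real (p choose k))"
  proof (rule mult_mono)
    have "real (k - j) * real p \<le> real k * real (p - j)"
      using Suc.prems assms(2) by (simp add: of_nat_diff algebra_simps mult_left_mono)
    then show "real (k - j) / real (p - j) \<le> real k / real p"
      using p' Suc.prems assms(2) by (simp add: divide_simps)
  qed (use Suc in auto)
  also have "p' = p - Suc j" and "k' = k - Suc j" using p' k' by auto
  ultimately show ?case by simp
qed simp

text \<open>
  Expanding \<open>(1 + z) ^ card (S \<inter> T)\<close> over the subsets of \<open>S \<inter> T\<close> bounds the moment
  generating function of a hypergeometric variable by that of a binomial one.
\<close>

lemma sum_power_card_Int_le:
  fixes z :: real
  assumes A: "finite A" "card A = p" and S: "S \<subseteq> A" "card S = k" and z: "z \<ge> 0"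
  shows "(\<Sum>T | T \<subseteq> A \<and> card T = k. (1 + z) ^ card (S \<inter> T))
    \<le> (1 + z * (real k / real p)) ^ k * real (p choose k)"
proof -
  let ?F = "{T. T \<subseteq> A \<and> card T = k}"
  have fS: "finite S" using A S finite_subset by blast
  have kp: "k \<le> p" using A S card_mono by blast
  have fF: "finite ?F" using A by simp
  have expand: "(1 + w) ^ card V = (\<Sum>U\<in>Pow V. w ^ card U)" if "finite V" for V :: "'a set" and w :: real
    using prod_add[OF that, of "\<lambda>_. w" "\<lambda>_. 1"] by (simp add: add.commute)
  have "(\<Sum>T\<in>?F. (1 + z) ^ card (S \<inter> T)) = (\<Sum>T\<in>?F. \<Sum>U\<in>Pow S. if U \<subseteq> T then z ^ card U else 0)"
  proof (rule sum.cong[OF refl])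
    fix T
    have P: "Pow (S \<inter> T) = {U \<in> Pow S. U \<subseteq> T}" by auto
    show "(1 + z) ^ card (S \<inter> T) = (\<Sum>U\<in>Pow S. if U \<subseteq> T then z ^ card U else 0)"
      using fS unfolding sum.inter_filter[OF finite_Pow_iff[THEN iffD2, OF fS], symmetric] P[symmetric]
      by (simp add: expand)
  qed
  also have "\<dots> = (\<Sum>U\<in>Pow S. \<Sum>T\<in>?F. if U \<subseteq> T then z ^ card U else 0)"
    by (rule sum.swap)
  \<comment> \<open>With the sums exchanged, each \<open>U\<close> is weighted by the number of sets
    \<open>T\<close> containing it; the independent inclusion probability \<open>k / p\<close> of a
    binomial model bounds that count.\<close>
  also have "\<dots> \<le> (\<Sum>U\<in>Pow S. (z * (real k / real p)) ^ card U * real (p choose k))"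
  proof (rule sum_mono)
    fix U assume "U \<in> Pow S"
    then have U: "U \<subseteq> A" "card U \<le> k" using S fS by (auto intro: card_mono)
    have "(\<Sum>T\<in>?F. if U \<subseteq> T then z ^ card U else 0) = (\<Sum>T\<in>{T \<in> ?F. U \<subseteq> T}. z ^ card U)"
      by (rule sum.inter_filter[OF fF, symmetric])
    also have "\<dots> = real (card {T. T \<subseteq> A \<and> card T = k \<and> U \<subseteq> T}) * z ^ card U"
      by (simp add: conj_assoc)
    also have "\<dots> \<le> ((real k / real p) ^ card U * real (p choose k)) * z ^ card U"
      using choose_diff_le[OF U(2) kp] z A by (simp add: card_supersets_of_card[OF A(1) U] mult_right_mono)
    finally show "(\<Sum>T\<in>?F. if U \<subseteq> T then z ^ card U else 0)
        \<le> (z * (real k / real p)) ^ card U * real (p choose k)"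
      by (simp only: power_mult_distrib ac_simps)
  qed
  also have "\<dots> = (1 + z * (real k / real p)) ^ k * real (p choose k)"
    using expand[OF fS] S by (simp flip: sum_distrib_right)
  finally show ?thesis .
qed

text \<open>The square of the claim follows from \<open>(1 - x) * (1 + 2 * x) \<ge> 1\<close>, valid
  up to \<open>x = 1 / 2\<close>, and \<open>1 + 2 * x \<le> exp (2 * x)\<close>. The cap
  \<open>1 / sqrt 2\<close> on the signal strength keeps the argument in this range.\<close>

lemma inverse_sqrt_one_minus_le_exp:
  fixes x :: real
  assumes "0 \<le> x" "x \<le> 1 / 2"
  shows "1 / sqrt (1 - x) \<le> exp x"
proof -
  have "0 \<le> x * (1 - 2 * x)" using assms by simp
  then have "1 \<le> (1 - x) * (1 + 2 * x)" by (simp add: algebra_simps)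
  also have "\<dots> \<le> (1 - x) * exp (2 * x)" using assms by (intro mult_left_mono exp_ge_add_one_self) auto
  also have "\<dots> = (1 - x) * (exp x)\<^sup>2" by (simp add: exp_double)
  finally have "1 \<le> sqrt ((1 - x) * (exp x)\<^sup>2)" by (simp only: real_sqrt_ge_one)
  also have "\<dots> = exp x * sqrt (1 - x)" by (simp add: real_sqrt_mult)
  finally show ?thesis using assms by (simp add: pos_divide_le_eq)
qed

section \<open>Testing errors bounded by the second moment of a likelihood ratio\<close>

text \<open>Here \<open>A\<close> is the rejection region, \<open>L\<close> stands for the
  likelihood ratio, and \<open>m\<close> dominates both errors. Each bound compares the power with
  \<open>prob A\<close> by a weighted AM-GM inequality: the first applies it to \<open>L\<close>,
  the second to \<open>L - 1\<close>, whose second moment is at most \<open>K - 1\<close>.\<close>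

lemma (in prob_space) testing_lower_bound:
  fixes L :: "'a \<Rightarrow> real"
  assumes L: "integrable M L" "expectation L = 1"
    and L2: "integrable M (\<lambda>x. (L x)\<^sup>2)" "expectation (\<lambda>x. (L x)\<^sup>2) \<le> K"
    and A: "A \<in> events"
    and m: "prob A \<le> m" "expectation (\<lambda>x. L x * indicator (space M - A) x) \<le> m"
  shows "1 / (4 * K) \<le> m" and "\<nu> > 0 \<Longrightarrow> K \<le> 1 + 8 * \<nu>\<^sup>2 \<Longrightarrow> 1 / 2 - \<nu> \<le> m"
proof -
  have i1: "integrable M (\<lambda>x. L x * indicator A x)" and i2: "integrable M (indicator A :: 'a \<Rightarrow> real)"
    using L A by (auto intro!: integrable_real_mult_indicator integrable_real_indicator
        simp: less_top[symmetric])
  define b where "b = expectation (\<lambda>x. L x * indicator (space M - A) x)"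
  have "b = expectation (\<lambda>x. L x - L x * indicator A x)"
    unfolding b_def by (rule Bochner_Integration.integral_cong) (auto simp: indicator_def)
  then have b: "expectation (\<lambda>x. L x * indicator A x) = 1 - b" using L i1 by simp
  have bm: "b \<le> m" using m by (simp add: b_def)
  have var: "expectation (\<lambda>x. (L x - 1)\<^sup>2) = expectation (\<lambda>x. (L x)\<^sup>2) - 1"
    and ivar: "integrable M (\<lambda>x. (L x - 1)\<^sup>2)"
    using L L2 by (simp_all add: power2_diff prob_space)
  have "0 \<le> expectation (\<lambda>x. (L x - 1)\<^sup>2)" by simp
  then have K1: "K \<ge> 1" using var L2 by simp
  \<comment> \<open>In \<open>L \<le> L^2 / (4 * K) + K\<close> the weight makes the quadratic term
    contribute at most \<open>1 / 4\<close> in expectation, while the constant is charged only on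
    \<open>A\<close>.\<close>
  have "1 - b \<le> expectation (\<lambda>x. (L x)\<^sup>2 / (4 * K) + K * indicator A x)"
    unfolding b[symmetric]
  proof (rule integral_mono[OF i1])
    fix x
    have "0 \<le> (L x - 2 * K)\<^sup>2 / (4 * K)" using K1 by simp
    also have "(L x - 2 * K)\<^sup>2 / (4 * K) = (L x)\<^sup>2 / (4 * K) + K - L x"
      using K1 by (simp add: field_simps power2_eq_square)
    finally show "L x * indicator A x \<le> (L x)\<^sup>2 / (4 * K) + K * indicator A x"
      using K1 by (auto simp: indicator_def)
  qed (use L2 i2 in auto)
  also have "\<dots> = expectation (\<lambda>x. (L x)\<^sup>2) / (4 * K) + K * prob A"
    using L2 i2 A by simp
  also have "\<dots> \<le> 1 / 4 + K * m"
    using K1 L2 m by (intro add_mono mult_left_mono) (auto simp: field_simps)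
  finally have "3 / 4 \<le> (K + 1) * m" using bm by (simp add: algebra_simps)
  \<comment> \<open>Since \<open>K \<ge> 1\<close>, the ratio \<open>(K + 1) / (4 * K)\<close> is at
    most \<open>3 / 4\<close>, so a smaller \<open>m\<close> would contradict the bound just
    obtained.\<close>
  moreover have "(K + 1) * m < 3 / 4" if "m < 1 / (4 * K)"
  proof -
    have "(K + 1) * m < (K + 1) * (1 / (4 * K))" using that K1 by (intro mult_strict_left_mono) auto
    also have "\<dots> \<le> 3 / 4" using K1 by (simp add: field_simps)
    finally show ?thesis .
  qed
  ultimately show "1 / (4 * K) \<le> m" by fastforce
  show "1 / 2 - \<nu> \<le> m" if \<nu>: "\<nu> > 0" "K \<le> 1 + 8 * \<nu>\<^sup>2"
  proof -
    \<comment> \<open>Subtracting the mean-zero term \<open>(L - 1) / 2\<close> turns the indicator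
      factor of \<open>L - 1\<close> into plus or minus one half, so the integrand is at most
      \<open>\<bar>L - 1\<bar> / 2\<close>.\<close>
    have "expectation (\<lambda>x. L x * indicator A x - indicator A x - (L x - 1) / 2) = 1 - b - prob A"
      using L i1 i2 A b by (simp add: prob_space)
    then have "1 - b - prob A = expectation (\<lambda>x. L x * indicator A x - indicator A x - (L x - 1) / 2)"
      by simp
    also have "\<dots> \<le> expectation (\<lambda>x. (L x - 1)\<^sup>2 / (8 * \<nu>) + \<nu> / 2)"
    proof (rule integral_mono)
      fix x
      have "\<bar>y\<bar> / 2 \<le> y\<^sup>2 / (8 * \<nu>) + \<nu> / 2" for y :: real
      proof -
        have "0 \<le> (\<bar>y\<bar> - 2 * \<nu>)\<^sup>2 / (8 * \<nu>)" using \<nu> by simp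
        also have "\<dots> = y\<^sup>2 / (8 * \<nu>) + \<nu> / 2 - \<bar>y\<bar> / 2"
          using \<nu> by (simp add: power2_diff field_simps) (simp add: power2_eq_square)
        finally show ?thesis by simp
      qed
      define q where "q = (L x - 1)\<^sup>2 / (8 * \<nu>) + \<nu> / 2"
      have *: "\<bar>L x - 1\<bar> / 2 \<le> q" unfolding q_def by fact
      show "L x * indicator A x - indicator A x - (L x - 1) / 2 \<le> (L x - 1)\<^sup>2 / (8 * \<nu>) + \<nu> / 2"
      proof (cases "x \<in> A")
        case True
        then have i: "indicator A x = (1 :: real)" by simp
        show ?thesis
          unfolding i q_def[symmetric] mult_1_right mult_zero_right using * by (auto simp: abs_le_iff diff_divide_distrib)
      next
        case False
        then have i: "indicator A x = (0 :: real)" by simp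
        show ?thesis
          unfolding i q_def[symmetric] mult_1_right mult_zero_right using * by (auto simp: abs_le_iff diff_divide_distrib)
      qed
    qed (use L i1 i2 ivar in auto)
    also have "\<dots> = (expectation (\<lambda>x. (L x)\<^sup>2) - 1) / (8 * \<nu>) + \<nu> / 2"
      using ivar var by (simp add: prob_space)
    also have "\<dots> \<le> 8 * \<nu>\<^sup>2 / (8 * \<nu>) + \<nu> / 2"
      using \<nu> L2 by (intro add_right_mono divide_right_mono) auto
    also have "\<dots> \<le> 2 * \<nu>" using \<nu> by (simp add: power2_eq_square)
    \<comment> \<open>Halving \<open>1 - 2 * \<nu> \<le> b + prob A \<le> 2 * m\<close> gives the
      claim.\<close>
    finally show ?thesis using bm m by simp
  qed
qed

text \<open>The uniform average of the \<open>g S\<close> takes the role of the likelihood ratio.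
  Its square is a double sum over \<open>F\<close>, so bounding each row bounds the second moment,
  and an average of quantities below \<open>m\<close> stays below \<open>m\<close>.\<close>

lemma (in prob_space) mixture_testing_lower_bound:
  fixes g :: "'i \<Rightarrow> 'a \<Rightarrow> real" and K :: real
  assumes F: "finite F" "F \<noteq> {}"
    and g: "\<And>S. S \<in> F \<Longrightarrow> integrable M (g S)" "\<And>S. S \<in> F \<Longrightarrow> expectation (g S) = 1"
    and gg: "\<And>S T. S \<in> F \<Longrightarrow> T \<in> F \<Longrightarrow> integrable M (\<lambda>x. g S x * g T x)"
    and K: "\<And>S. S \<in> F \<Longrightarrow> (\<Sum>T\<in>F. expectation (\<lambda>x. g S x * g T x)) \<le> K * card F"
    and A: "A \<in> events" and m: "prob A \<le> m"
      "\<And>S. S \<in> F \<Longrightarrow> expectation (\<lambda>x. g S x * indicator (space M - A) x) \<le> m"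
  shows "1 / (4 * K) \<le> m" and "\<nu> > 0 \<Longrightarrow> K \<le> 1 + 8 * \<nu>\<^sup>2 \<Longrightarrow> 1 / 2 - \<nu> \<le> m"
proof -
  define N where "N = real (card F)"
  have N: "N > 0" using F by (simp add: N_def card_gt_0_iff)
  define L where "L x = (\<Sum>S\<in>F. g S x) / N" for x
  have L: "integrable M L" "expectation L = 1"
    using g N unfolding L_def by (auto simp: Bochner_Integration.integral_sum N_def)
  have sq: "(L x)\<^sup>2 = (\<Sum>S\<in>F. \<Sum>T\<in>F. g S x * g T x) / N\<^sup>2" for x
    by (simp add: L_def power_divide power2_eq_square sum_product)
  have L2: "integrable M (\<lambda>x. (L x)\<^sup>2)" unfolding sq using gg by auto
  have "expectation (\<lambda>x. (L x)\<^sup>2) = (\<Sum>S\<in>F. \<Sum>T\<in>F. expectation (\<lambda>x. g S x * g T x)) / N\<^sup>2"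
    unfolding sq using gg by (subst integral_divide_zero) (simp add: Bochner_Integration.integral_sum)
  also have "\<dots> \<le> (\<Sum>S\<in>F. K * N) / N\<^sup>2"
    using K by (intro divide_right_mono sum_mono) (auto simp: N_def)
  also have "\<dots> = K" using N by (simp add: power2_eq_square flip: N_def)
  finally have L2K: "expectation (\<lambda>x. (L x)\<^sup>2) \<le> K" .
  have ig: "integrable M (\<lambda>x. g S x * indicator (space M - A) x)" if "S \<in> F" for S
    using g(1)[OF that] A by (intro integrable_real_mult_indicator) auto
  have "expectation (\<lambda>x. L x * indicator (space M - A) x)
      = (\<Sum>S\<in>F. expectation (\<lambda>x. g S x * indicator (space M - A) x)) / N"
    using ig by (simp add: L_def sum_distrib_right Bochner_Integration.integral_sum)
  also have "\<dots> \<le> (\<Sum>S\<in>F. m) / N"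
    using m N by (intro divide_right_mono sum_mono) auto
  also have "\<dots> = m" using N by (simp flip: N_def)
  finally have "expectation (\<lambda>x. L x * indicator (space M - A) x) \<le> m" .
  note * = testing_lower_bound[OF L L2 L2K A m(1) this]
  show "1 / (4 * K) \<le> m" by (rule *(1))
  show "1 / 2 - \<nu> \<le> m" if "\<nu> > 0" "K \<le> 1 + 8 * \<nu>\<^sup>2" using *(2) that .
qed

section \<open>The spiked covariance model\<close>

text \<open>A density relative to the standard normal law, not to Lebesgue measure. The direction
  \<open>v\<close> is a plain function, so the Gaussian integrals apply without matrices.\<close>

definition spiked_density :: "nat \<Rightarrow> real \<Rightarrow> (nat \<Rightarrow> real) \<Rightarrow> (nat \<Rightarrow> real) \<Rightarrow> real" where
  "spiked_density p \<theta> v x = exp (\<theta> / (1 + \<theta>) * (\<Sum>i<p. v i * x i)\<^sup>2 / 2) / sqrt (1 + \<theta>)"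

abbreviation std_normal_vec :: "nat \<Rightarrow> (nat \<Rightarrow> real) measure" where
  "std_normal_vec p \<equiv> PiM {..<p} (\<lambda>_. std_normal)"

lemma spiked_density_measurable [measurable]:
  "spiked_density p \<theta> v \<in> borel_measurable (std_normal_vec p)"
  unfolding spiked_density_def by measurable

lemma spiked_density_nonneg: "\<theta> > 0 \<Longrightarrow> spiked_density p \<theta> v x \<ge> 0"
  by (simp add: spiked_density_def)

lemma prob_space_std_normal_vec: "prob_space (std_normal_vec p)"
  by (intro prob_space_PiM prob_space_std_normal)

lemma std_normal_vec_eq_density:
  "std_normal_vec p = density (PiM {..<p} (\<lambda>_. lborel)) (\<lambda>x. \<Prod>i<p. ennreal (std_normal_density (x i)))"
  by (intro density_PiM prob_space_imp_sigma_finite prob_space_std_normal lborel.sigma_finite_measure_axioms) auto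

lemma prod_std_normal_density:
  "(\<Prod>i<p. std_normal_density (x i)) = exp (- (\<Sum>i<p. (x i)\<^sup>2) / 2) / sqrt ((2 * pi) ^ p)"
proof -
  have "(\<Prod>i<p. std_normal_density (x i)) = (\<Prod>i<p. exp (- (x i)\<^sup>2 / 2)) / (\<Prod>i<p. sqrt (2 * pi))"
    by (simp add: std_normal_density_def prod_dividef)
  also have "\<dots> = exp (\<Sum>i<p. - (x i)\<^sup>2 / 2) / sqrt (2 * pi) ^ p"
    by (simp add: exp_sum)
  finally show ?thesis by 
    (simp add: sum_negf sum_divide_distrib real_sqrt_power real_sqrt_mult power_mult_distrib)
qed

lemma P0_eq: "P0 p = std_normal_vec p"
proof -
  have "mat_inverse (1\<^sub>m p :: real mat) = Some (1\<^sub>m p)"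
    by (rule mat_inverse_eq_SomeI[of _ p]) auto
  then show ?thesis
    unfolding P0_def gaussian_def std_normal_vec_eq_density
    by (simp add: prod_ennreal prod_std_normal_density scalar_prod_def atLeast0LessThan power2_eq_square)
qed

text \<open>The inverse matrix splits the exponent into the standard normal part and the square of
  the form in \<open>v\<close>; the determinant supplies the factor
  \<open>1 + \<theta>\<close>.\<close>

lemma Pv_eq_density:
  assumes "\<theta> > 0" and v: "(\<Sum>i<p. (vec_index v i)\<^sup>2) = 1"
  shows "Pv p \<theta> v = density (std_normal_vec p) (\<lambda>x. ennreal (spiked_density p \<theta> (vec_index v) x))"
proof -
  have [measurable]: "(\<lambda>x. ennreal (spiked_density p \<theta> (vec_index v) x)) \<in> borel_measurable (PiM {..<p} (\<lambda>_. lborel))"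
    unfolding spiked_density_def by measurable
  have eq: "exp (- scalar_prod (Matrix.vec p x) (the (mat_inverse (1\<^sub>m p + \<theta> \<cdot>\<^sub>m outer p v)) *\<^sub>v Matrix.vec p x) / 2)
         / sqrt ((2 * pi) ^ p * Determinant.det (1\<^sub>m p + \<theta> \<cdot>\<^sub>m outer p v))
     = (\<Prod>i<p. std_normal_density (x i)) * spiked_density p \<theta> (vec_index v) x" for x
  proof -
    define s where "s = (\<Sum>i<p. (x i)\<^sup>2)"
    define t where "t = \<theta> / (1 + \<theta>) * (\<Sum>i<p. vec_index v i * x i)\<^sup>2"
    have "exp (- (s - t) / 2) = exp (- s / 2) * exp (t / 2)"
      by (simp add: diff_divide_distrib flip: exp_add)
    moreover have "mat_inverse (1\<^sub>m p + \<theta> \<cdot>\<^sub>m outer p v)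
        = Some (1\<^sub>m p + (- (\<theta> / (1 + \<theta>))) \<cdot>\<^sub>m outer p v)"
      using assms by (intro mat_inverse_rank_one_update) auto
    ultimately show ?thesis
      using v unfolding prod_std_normal_density spiked_density_def option.sel quadratic_form_rank_one_update
        det_rank_one_update s_def[symmetric] t_def[symmetric]
      by (simp add: quadratic_form_rank_one_update real_sqrt_mult s_def t_def)
  qed
  show ?thesis
    unfolding Pv_def gaussian_def std_normal_vec_eq_density eq
    by (subst density_density_eq)
      (auto simp: prod_ennreal ennreal_mult'' spiked_density_nonneg assms prod_nonneg intro!: density_cong)
qed

text \<open>Besides normalising the likelihood ratio, this makes the alternative a probability
  measure, which yields the sigma-finiteness behind its product measure.\<close>

lemma nn_integral_spiked_density:
  assumes "\<theta> > 0" "(\<Sum>i<p. (v i)\<^sup>2) = 1"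
  shows "(\<integral>\<^sup>+x. ennreal (spiked_density p \<theta> v x) \<partial>std_normal_vec p) = 1"
proof -
  have c: "0 \<le> \<theta> / (1 + \<theta>)" "\<theta> / (1 + \<theta>) < 1" "1 - \<theta> / (1 + \<theta>) = 1 / (1 + \<theta>)"
    using assms by (auto simp: field_simps)
  have "(\<integral>\<^sup>+x. ennreal (spiked_density p \<theta> v x) \<partial>std_normal_vec p)
     = (\<integral>\<^sup>+x. ennreal (exp (\<theta> / (1 + \<theta>) * (\<Sum>i<p. v i * x i)\<^sup>2 / 2)) * ennreal (1 / sqrt (1 + \<theta>)) \<partial>std_normal_vec p)"
    using assms unfolding spiked_density_def by (simp add: ennreal_mult'[symmetric])
  also have "\<dots> = ennreal (1 / sqrt (1 / (1 + \<theta>))) * ennreal (1 / sqrt (1 + \<theta>))"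
    by (subst nn_integral_multc, measurable, subst nn_integral_PiM_std_normal_exp_square)
      (use c assms in auto)
  also have "\<dots> = 1" using assms by (simp add: ennreal_mult'[symmetric] real_sqrt_divide)
  finally show ?thesis .
qed

text \<open>For \<open>c = \<theta> / (1 + \<theta>)\<close> the determinant
  \<open>(1 - c)^2 - (c * r)^2\<close> is \<open>(1 - (\<theta> * r)^2) / (1 + \<theta>)^2\<close>,
  whose denominator cancels the two normalising factors.\<close>

lemma nn_integral_spiked_density_mult:
  assumes \<theta>: "0 < \<theta>" "\<theta> < 1" and u: "(\<Sum>i<p. (u i)\<^sup>2) = 1" and v: "(\<Sum>i<p. (v i)\<^sup>2) = 1"
    and r: "(\<Sum>i<p. u i * v i) = r" "\<bar>r\<bar> \<le> 1"
  shows "(\<integral>\<^sup>+x. ennreal (spiked_density p \<theta> u x * spiked_density p \<theta> v x) \<partial>std_normal_vec p)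
    = ennreal (1 / sqrt (1 - (\<theta> * r)\<^sup>2))"
proof -
  define c where "c = \<theta> / (1 + \<theta>)"
  have c: "0 \<le> c" "c < 1" "1 - c = 1 / (1 + \<theta>)"
    using \<theta> by (auto simp: c_def field_simps)
  have "\<theta> * \<bar>r\<bar> \<le> \<theta> * 1" using \<theta> r by (intro mult_left_mono) auto
  then have "\<theta> * \<bar>r\<bar> < 1" using \<theta> by linarith
  \<comment> \<open>Because \<open>c / (1 - c) = \<theta>\<close>, this is
    \<open>\<theta> * \<bar>r\<bar> < 1\<close> divided by \<open>1 + \<theta>\<close>.\<close>
  then have cr: "c * \<bar>r\<bar> < 1 - c" unfolding c(3) using \<theta> by (simp add: c_def divide_strict_right_mono)
  let ?f = "\<lambda>x. exp (c * (\<Sum>i<p. u i * x i)\<^sup>2 / 2) * exp (c * (\<Sum>i<p. v i * x i)\<^sup>2 / 2)"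
  have "(\<integral>\<^sup>+x. ennreal (spiked_density p \<theta> u x * spiked_density p \<theta> v x) \<partial>std_normal_vec p)
     = (\<integral>\<^sup>+x. ennreal (?f x) * ennreal (1 / (1 + \<theta>)) \<partial>std_normal_vec p)"
    using \<theta> unfolding spiked_density_def c_def[symmetric]
    by (intro nn_integral_cong) (simp add: ennreal_mult'[symmetric])
  also have "\<dots> = ennreal (1 / sqrt ((1 - c)\<^sup>2 - (c * r)\<^sup>2)) * ennreal (1 / (1 + \<theta>))"
    by (subst nn_integral_multc, measurable, subst nn_integral_PiM_std_normal_exp_square2)
      (use c cr u v r in auto)
  also have "(1 - c)\<^sup>2 - (c * r)\<^sup>2 = (1 - (\<theta> * r)\<^sup>2) / (1 + \<theta>)\<^sup>2"
    unfolding c(3) by (simp add: c_def power_divide power_mult_distrib diff_divide_distrib)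
  also have "ennreal (1 / sqrt ((1 - (\<theta> * r)\<^sup>2) / (1 + \<theta>)\<^sup>2)) * ennreal (1 / (1 + \<theta>))
      = ennreal (1 / sqrt (1 - (\<theta> * r)\<^sup>2))"
    using \<theta> by (simp add: ennreal_mult''[symmetric] real_sqrt_divide)
  finally show ?thesis .
qed

section \<open>Likelihood ratio of the whole sample\<close>

definition iid_spiked_density :: "nat \<Rightarrow> nat \<Rightarrow> real \<Rightarrow> (nat \<Rightarrow> real) \<Rightarrow> (nat \<Rightarrow> nat \<Rightarrow> real) \<Rightarrow> real" where
  "iid_spiked_density n p \<theta> v X = (\<Prod>i<n. spiked_density p \<theta> v (X i))"

abbreviation std_normal_sample :: "nat \<Rightarrow> nat \<Rightarrow> (nat \<Rightarrow> nat \<Rightarrow> real) measure" where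
  "std_normal_sample n p \<equiv> PiM {..<n} (\<lambda>_. std_normal_vec p)"

lemma iid_spiked_density_measurable [measurable]:
  "iid_spiked_density n p \<theta> v \<in> borel_measurable (std_normal_sample n p)"
  unfolding iid_spiked_density_def by measurable

lemma iid_spiked_density_nonneg: "\<theta> > 0 \<Longrightarrow> iid_spiked_density n p \<theta> v X \<ge> 0"
  by (simp add: iid_spiked_density_def prod_nonneg spiked_density_nonneg)

lemma iid_Pv_eq_density:
  assumes "\<theta> > 0" and v: "(\<Sum>i<p. (vec_index v i)\<^sup>2) = 1"
  shows "iid n (Pv p \<theta> v)
    = density (std_normal_sample n p) (\<lambda>X. ennreal (iid_spiked_density n p \<theta> (vec_index v) X))"
proof -
  interpret prob_space "std_normal_vec p" by (rule prob_space_std_normal_vec)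
  have "prob_space (density (std_normal_vec p) (\<lambda>x. ennreal (spiked_density p \<theta> (vec_index v) x)))"
    using nn_integral_spiked_density[OF assms] by (intro prob_spaceI) (simp add: emeasure_density)
  then show ?thesis
    unfolding iid_def Pv_eq_density[OF assms] iid_spiked_density_def
    by (subst density_PiM)
      (auto simp: prod_ennreal spiked_density_nonneg assms prob_space_imp_sigma_finite
        intro: sigma_finite_measure_axioms)
qed

lemma integral_iid_spiked_density:
  assumes "\<theta> > 0" "(\<Sum>i<p. (v i)\<^sup>2) = 1"
  shows "integrable (std_normal_sample n p) (iid_spiked_density n p \<theta> v)"
    and "integral\<^sup>L (std_normal_sample n p) (iid_spiked_density n p \<theta> v) = 1"
proof -
  interpret prob_space "std_normal_vec p" by (rule prob_space_std_normal_vec)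
  interpret product_sigma_finite "\<lambda>_. std_normal_vec p" ..
  have "(\<integral>\<^sup>+X. ennreal (iid_spiked_density n p \<theta> v X) \<partial>std_normal_sample n p)
      = (\<integral>\<^sup>+X. (\<Prod>i<n. ennreal (spiked_density p \<theta> v (X i))) \<partial>std_normal_sample n p)"
    using assms by (simp add: iid_spiked_density_def prod_ennreal spiked_density_nonneg)
  also have "\<dots> = ennreal 1"
    by (subst product_nn_integral_prod) (use assms in \<open>auto simp: nn_integral_spiked_density\<close>)
  finally have "integrable (std_normal_sample n p) (iid_spiked_density n p \<theta> v)
      \<and> integral\<^sup>L (std_normal_sample n p) (iid_spiked_density n p \<theta> v) = 1"
    using assms by (subst (asm) nn_integral_eq_integrable) (auto simp: iid_spiked_density_nonneg)
  then show "integrable (std_normal_sample n p) (iid_spiked_density n p \<theta> v)"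
    and "integral\<^sup>L (std_normal_sample n p) (iid_spiked_density n p \<theta> v) = 1" by auto
qed

text \<open>By independence the integral factors over the observations. Integrability and value are
  both read off from one finite integral of a nonnegative function.\<close>

lemma integral_iid_spiked_density_mult:
  fixes n :: nat
  assumes \<theta>: "0 < \<theta>" "\<theta> < 1" and u: "(\<Sum>i<p. (u i)\<^sup>2) = 1" and v: "(\<Sum>i<p. (v i)\<^sup>2) = 1"
    and r: "(\<Sum>i<p. u i * v i) = r" "\<bar>r\<bar> \<le> 1"
  defines "f \<equiv> \<lambda>X. iid_spiked_density n p \<theta> u X * iid_spiked_density n p \<theta> v X"
  shows "integrable (std_normal_sample n p) f"
    and "integral\<^sup>L (std_normal_sample n p) f = (1 / sqrt (1 - (\<theta> * r)\<^sup>2)) ^ n"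
proof -
  interpret prob_space "std_normal_vec p" by (rule prob_space_std_normal_vec)
  interpret product_sigma_finite "\<lambda>_. std_normal_vec p" ..
  have "(\<theta> * \<bar>r\<bar>)\<^sup>2 \<le> 1" using \<theta> r by (intro power_le_one mult_le_one) auto
  then have r1: "0 \<le> 1 / sqrt (1 - (\<theta> * r)\<^sup>2)" by (simp add: power_mult_distrib)
  have [measurable]: "f \<in> borel_measurable (std_normal_sample n p)" unfolding f_def by measurable
  have "(\<integral>\<^sup>+X. ennreal (f X) \<partial>std_normal_sample n p)
      = (\<integral>\<^sup>+X. (\<Prod>i<n. ennreal (spiked_density p \<theta> u (X i) * spiked_density p \<theta> v (X i))) \<partial>std_normal_sample n p)"
    using \<theta> by (simp add: f_def iid_spiked_density_def prod_ennreal spiked_density_nonneg prod.distrib)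
  also have "\<dots> = (\<Prod>i<n. ennreal (1 / sqrt (1 - (\<theta> * r)\<^sup>2)))"
    by (subst product_nn_integral_prod, simp, measurable)
      (use assms in \<open>simp add: nn_integral_spiked_density_mult\<close>)
  also have "\<dots> = ennreal ((1 / sqrt (1 - (\<theta> * r)\<^sup>2)) ^ n)"
    using r1 by (simp only: prod_constant card_lessThan ennreal_power)
  finally have "integrable (std_normal_sample n p) f
      \<and> integral\<^sup>L (std_normal_sample n p) f = (1 / sqrt (1 - (\<theta> * r)\<^sup>2)) ^ n"
    using \<theta> r1 by (subst (asm) nn_integral_eq_integrable)
      (simp_all add: f_def iid_spiked_density_nonneg del: power_one_over)
  then show "integrable (std_normal_sample n p) f"
    and "integral\<^sup>L (std_normal_sample n p) f = (1 / sqrt (1 - (\<theta> * r)\<^sup>2)) ^ n" by auto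
qed

section \<open>Flat sparse directions and their overlaps\<close>

definition flat_vec :: "nat \<Rightarrow> nat set \<Rightarrow> nat \<Rightarrow> real" where
  "flat_vec k S i = (if i \<in> S then 1 / sqrt (real k) else 0)"

lemma sum_flat_vec_mult:
  assumes "S \<subseteq> {..<p}"
  shows "(\<Sum>i<p. flat_vec k S i * flat_vec k T i) = real (card (S \<inter> T)) / real k"
proof -
  have "flat_vec k S i * flat_vec k T i = (if i \<in> S \<inter> T then 1 / real k else 0)" for i
    by (simp add: flat_vec_def)
  then have "(\<Sum>i<p. flat_vec k S i * flat_vec k T i) = (\<Sum>i<p. if i \<in> S \<inter> T then 1 / real k else 0)"
    by simp
  also have "\<dots> = (\<Sum>i\<in>{..<p} \<inter> (S \<inter> T). 1 / real k)"
    by (rule sum.inter_restrict[symmetric]) simp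
  also have "{..<p} \<inter> (S \<inter> T) = S \<inter> T" using assms by auto
  finally show ?thesis by simp
qed

lemma flat_vec_unit:
  assumes "S \<subseteq> {..<p}" "card S = k" "k > 0"
  shows "(\<Sum>i<p. (flat_vec k S i)\<^sup>2) = 1"
  using sum_flat_vec_mult[OF assms(1), of k S] assms by (simp add: power2_eq_square)

text \<open>With \<open>r = R / k\<close> the left side is at most
  \<open>exp (n * \<theta>^2 * r^2)\<close>. The threshold gives
  \<open>n * \<theta>^2 \<le> k * ln (1 + z)\<close>, and \<open>r^2 \<le> r\<close> makes the
  exponent linear in the overlap, so that the subset count can average it.\<close>

lemma second_moment_exponent_le:
  fixes \<theta> z :: real
  assumes "n > 0" "R \<le> k" "k > 0" and z: "z \<ge> 0"
    and \<theta>: "0 < \<theta>" "\<theta> \<le> sqrt (real k * ln (1 + z) / real n)" "\<theta> \<le> 1 / sqrt 2"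
  shows "(1 / sqrt (1 - (\<theta> * (real R / real k))\<^sup>2)) ^ n \<le> (1 + z) ^ R"
proof -
  define r where "r = real R / real k"
  have r: "0 \<le> r" "r \<le> 1" using assms by (auto simp: r_def)
  have "\<theta>\<^sup>2 \<le> (1 / sqrt 2)\<^sup>2" using \<theta> by (intro power_mono) auto
  then have \<theta>2: "\<theta>\<^sup>2 \<le> 1 / 2" by (simp add: power_divide)
  have r2: "r\<^sup>2 \<le> r" using r by (simp add: power2_eq_square mult_left_le)
  have "\<theta>\<^sup>2 * r\<^sup>2 \<le> 1 / 2 * 1" using \<theta>2 r r2 by (intro mult_mono) auto
  then have x: "0 \<le> (\<theta> * r)\<^sup>2" "(\<theta> * r)\<^sup>2 \<le> 1 / 2" by (auto simp: power_mult_distrib)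
  have "\<theta>\<^sup>2 \<le> (sqrt (real k * ln (1 + z) / real n))\<^sup>2" using \<theta> by (intro power_mono) auto
  also have "\<dots> = real k * ln (1 + z) / real n" using z by simp
  finally have n\<theta>: "real n * \<theta>\<^sup>2 \<le> real k * ln (1 + z)" using assms by (simp add: field_simps)
  have "(1 / sqrt (1 - (\<theta> * r)\<^sup>2)) ^ n \<le> exp ((\<theta> * r)\<^sup>2) ^ n"
    using x by (intro power_mono inverse_sqrt_one_minus_le_exp) auto
  also have "\<dots> = exp (real n * \<theta>\<^sup>2 * r\<^sup>2)" by (simp add: exp_of_nat_mult[symmetric] power_mult_distrib)
  also have "\<dots> \<le> exp (real k * ln (1 + z) * r)"
    unfolding exp_le_cancel_iff by (rule mult_mono) (use n\<theta> r r2 z in auto)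
  also have "real k * ln (1 + z) * r = real R * ln (1 + z)" using assms by (simp add: r_def)
  also have "exp (real R * ln (1 + z)) = (1 + z) ^ R" using z by (simp add: exp_of_nat_mult)
  finally show ?thesis by (simp add: r_def)
qed

lemma B0_unit: "v \<in> B0 p k \<Longrightarrow> (\<Sum>i<p. (vec_index v i)\<^sup>2) = 1"
  by (simp add: B0_def L2_set_def)

lemma flat_vec_in_B0:
  assumes "S \<subseteq> {..<p}" "card S = k" "k > 0"
  shows "Matrix.vec p (flat_vec k S) \<in> B0 p k"
proof -
  have "{i. i < p \<and> vec_index (Matrix.vec p (flat_vec k S)) i \<noteq> 0} \<subseteq> S"
    by (auto simp: flat_vec_def split: if_splits)
  then have "card {i. i < p \<and> vec_index (Matrix.vec p (flat_vec k S)) i \<noteq> 0} \<le> k"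
    using assms by (metis card_mono finite_subset finite_lessThan)
  then show ?thesis using flat_vec_unit[OF assms] by (simp add: B0_def L2_set_def)
qed

section \<open>Lower bound on the risk of a single test\<close>

text \<open>The mixture bounds for the flat directions, with \<open>exp C\<close> as second moment.
  They stay separate because the one that is needed depends on how \<open>C\<close> is obtained from
  \<open>\<nu>\<close>.\<close>

lemma max_risk_lower_bound:
  fixes C \<theta> :: real
  assumes n: "n > 0" and k: "k > 0" "k \<le> p" and \<theta>: "0 < \<theta>" "\<theta> < threshold C n p k" and C: "C > 0"
    and \<psi>: "\<psi> \<in> tests n p"
  defines "m \<equiv> max (P_event (iid n (P0 p)) (\<lambda>X. \<psi> X = 1))
              (SUP v \<in> B0 p k. P_event (iid n (Pv p \<theta> v)) (\<lambda>X. \<psi> X = 0))"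
  shows "1 / (4 * exp C) \<le> m" and "\<nu> > 0 \<Longrightarrow> exp C \<le> 1 + 8 * \<nu>\<^sup>2 \<Longrightarrow> 1 / 2 - \<nu> \<le> m"
proof -
  let ?Q = "std_normal_sample n p"
  interpret Q: prob_space ?Q by (intro prob_space_PiM prob_space_std_normal_vec)
  \<comment> \<open>The summand added to 1 under the logarithm in \<open>threshold\<close>, scaled
    so that \<open>z * (k / p) = C / k\<close>.\<close>
  define z where "z = C * real p / (real k)\<^sup>2"
  have z: "z \<ge> 0" using C by (simp add: z_def)
  have \<theta>': "\<theta> \<le> sqrt (real k * ln (1 + z) / real n)" "\<theta> \<le> 1 / sqrt 2"
    using \<theta> by (auto simp: threshold_def z_def add.commute)
  have "1 / sqrt 2 < (1 :: real)" by simp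
  then have \<theta>1: "\<theta> < 1" using \<theta>' by linarith
  have sets: "sets ?Q = sets (iid n (PiM {..<p} (\<lambda>_. borel)))"
    unfolding iid_def by (intro sets_PiM_cong sets_PiM_std_normal) auto
  have \<psi>': "\<psi> \<in> ?Q \<rightarrow>\<^sub>M count_space {0, 1}"
    using \<psi> unfolding tests_def by (subst measurable_cong_sets[OF sets refl])
  define A where "A = {X \<in> space ?Q. \<psi> X = 1}"
  have A: "A \<in> sets ?Q"
    using measurable_sets[OF \<psi>', of "{1}"] by (simp add: A_def vimage_def Int_def conj_commute)
  have Ac: "{X \<in> space ?Q. \<psi> X = 0} = space ?Q - A"
    using measurable_space[OF \<psi>'] by (auto simp: A_def)
  have error0: "P_event (iid n (P0 p)) (\<lambda>X. \<psi> X = 1) = measure ?Q A"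
    by (simp add: P_event_def iid_def P0_eq A_def)
  \<comment> \<open>The bound by 1 keeps the set under the supremum bounded above, so that its
    members lie below the real-valued \<open>SUP\<close>.\<close>
  have error1: "P_event (iid n (Pv p \<theta> v)) (\<lambda>X. \<psi> X = 0)
      = Q.expectation (\<lambda>X. iid_spiked_density n p \<theta> (vec_index v) X * indicator (space ?Q - A) X)"
    and error1_le: "P_event (iid n (Pv p \<theta> v)) (\<lambda>X. \<psi> X = 0) \<le> 1" if "v \<in> B0 p k" for v
  proof -
    note v = B0_unit[OF that]
    let ?g = "iid_spiked_density n p \<theta> (vec_index v)"
    have "P_event (iid n (Pv p \<theta> v)) (\<lambda>X. \<psi> X = 0)
        = enn2real (emeasure (density ?Q (\<lambda>X. ennreal (?g X))) (space ?Q - A))"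
      unfolding P_event_def iid_Pv_eq_density[OF \<theta>(1) v] by (simp add: Ac measure_def)
    also have "emeasure (density ?Q (\<lambda>X. ennreal (?g X))) (space ?Q - A)
        = (\<integral>\<^sup>+X. ennreal (?g X * indicator (space ?Q - A) X) \<partial>?Q)"
      using A by (subst emeasure_density) (auto intro!: nn_integral_cong simp: indicator_def)
    also have "\<dots> = ennreal (Q.expectation (\<lambda>X. ?g X * indicator (space ?Q - A) X))"
      using A \<theta> by (intro nn_integral_eq_integral integrable_real_mult_indicator
          integral_iid_spiked_density(1) v) (auto simp: iid_spiked_density_nonneg)
    also have "enn2real \<dots> = Q.expectation (\<lambda>X. ?g X * indicator (space ?Q - A) X)"
      using \<theta> by (intro enn2real_ennreal integral_nonneg_AE) (auto simp: iid_spiked_density_nonneg)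
    finally show eq: "P_event (iid n (Pv p \<theta> v)) (\<lambda>X. \<psi> X = 0)
        = Q.expectation (\<lambda>X. ?g X * indicator (space ?Q - A) X)" .
    also have "\<dots> \<le> Q.expectation ?g"
      using A \<theta> by (intro integral_mono integrable_real_mult_indicator integral_iid_spiked_density(1) v)
        (auto simp: indicator_def iid_spiked_density_nonneg)
    finally show "P_event (iid n (Pv p \<theta> v)) (\<lambda>X. \<psi> X = 0) \<le> 1"
      using integral_iid_spiked_density(2)[OF \<theta>(1) v] by simp
  qed
  define F where "F = {S. S \<subseteq> {..<p} \<and> card S = k}"
  have cF: "card F = p choose k" unfolding F_def using n_subsets[of "{..<p}" k] by simp
  then have "card F > 0" using k by simp
  then have F: "finite F" "F \<noteq> {}" by (simp_all add: card_gt_0_iff)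
  define g where "g S = iid_spiked_density n p \<theta> (flat_vec k S)" for S
  have unit: "(\<Sum>i<p. (flat_vec k S i)\<^sup>2) = 1" if "S \<in> F" for S
    using that k by (intro flat_vec_unit) (auto simp: F_def)
  have g: "integrable ?Q (g S)" "Q.expectation (g S) = 1" if "S \<in> F" for S
    unfolding g_def using integral_iid_spiked_density[OF \<theta>(1) unit[OF that]] by auto
  have gg: "integrable ?Q (\<lambda>X. g S X * g T X)"
    "Q.expectation (\<lambda>X. g S X * g T X) \<le> (1 + z) ^ card (S \<inter> T)" if "S \<in> F" "T \<in> F" for S T
  proof -
    have "finite S" using that by (auto simp: F_def intro: finite_subset)
    then have le: "card (S \<inter> T) \<le> k" using that card_mono[of S "S \<inter> T"] by (auto simp: F_def)
    have "(\<Sum>i<p. flat_vec k S i * flat_vec k T i) = real (card (S \<inter> T)) / real k"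
      using that by (intro sum_flat_vec_mult) (auto simp: F_def)
    note * = integral_iid_spiked_density_mult[OF \<theta>(1) \<theta>1 unit[OF that(1)] unit[OF that(2)] this]
    show "integrable ?Q (\<lambda>X. g S X * g T X)" unfolding g_def by (rule *) (use le k in simp)
    show "Q.expectation (\<lambda>X. g S X * g T X) \<le> (1 + z) ^ card (S \<inter> T)"
      unfolding g_def using second_moment_exponent_le[OF n le k(1) z \<theta>(1) \<theta>'] le k by (subst *) auto
  qed
  have K: "(\<Sum>T\<in>F. Q.expectation (\<lambda>X. g S X * g T X)) \<le> exp C * card F" if S: "S \<in> F" for S
  proof -
    have "(\<Sum>T\<in>F. Q.expectation (\<lambda>X. g S X * g T X)) \<le> (\<Sum>T\<in>F. (1 + z) ^ card (S \<inter> T))"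
      using gg S by (intro sum_mono) auto
    also have "\<dots> \<le> (1 + z * (real k / real p)) ^ k * real (p choose k)"
      unfolding F_def using S z by (intro sum_power_card_Int_le) (auto simp: F_def)
    \<comment> \<open>The dimension cancels here, and \<open>1 + C / k \<le> exp (C / k)\<close>
      then removes the sparsity.\<close>
    also have "z * (real k / real p) = C / real k"
      using k by (simp add: z_def power2_eq_square)
    also have "(1 + C / real k) ^ k \<le> exp (C / real k) ^ k"
      using C by (intro power_mono exp_ge_add_one_self) auto
    also have "\<dots> = exp C" using k by (simp flip: exp_of_nat_mult)
    finally show ?thesis by (simp add: cF mult_right_mono)
  qed
  have m0: "Q.prob A \<le> m" unfolding m_def error0 by (rule max.cobounded1)
  have m1: "Q.expectation (\<lambda>X. g S X * indicator (space ?Q - A) X) \<le> m" if "S \<in> F" for S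
  proof -
    have B0: "Matrix.vec p (flat_vec k S) \<in> B0 p k"
      using that k by (intro flat_vec_in_B0) (auto simp: F_def)
    \<comment> \<open>The likelihood ratio reads its direction only at indices below
      \<open>p\<close>, so the passage through \<open>Matrix.vec\<close> does not change it.\<close>
    have "g S = iid_spiked_density n p \<theta> (vec_index (Matrix.vec p (flat_vec k S)))"
      by (simp add: g_def fun_eq_iff iid_spiked_density_def spiked_density_def)
    then have "Q.expectation (\<lambda>X. g S X * indicator (space ?Q - A) X)
        = P_event (iid n (Pv p \<theta> (Matrix.vec p (flat_vec k S)))) (\<lambda>X. \<psi> X = 0)"
      by (simp add: error1[OF B0])
    also have "\<dots> \<le> (SUP v \<in> B0 p k. P_event (iid n (Pv p \<theta> v)) (\<lambda>X. \<psi> X = 0))"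
      using error1_le by (intro cSUP_upper B0) (auto intro!: bdd_aboveI[of _ 1])
    finally show ?thesis by (simp add: m_def)
  qed
  note * = Q.mixture_testing_lower_bound[OF F g gg(1) K A m0 m1]
  show "1 / (4 * exp C) \<le> m" by (rule *(1))
  show "1 / 2 - \<nu> \<le> m" if "\<nu> > 0" "exp C \<le> 1 + 8 * \<nu>\<^sup>2" using *(2) that by blast
qed

theorem theorem5p1:
  fixes \<nu> :: real
  assumes "\<nu> > 0"
  shows "\<exists>C>0.
    (\<nu> < 1 / 2 \<longrightarrow> C = ln (max (1 + 8 * \<nu>\<^sup>2) (ln (exp 1 / (2 - 4 * \<nu>))))) \<and>
    (\<forall>(n::nat) (p::nat) (k::nat) (\<theta>::real).
       n > 0 \<longrightarrow> p > 0 \<longrightarrow> k > 0 \<longrightarrow> k \<le> p \<longrightarrow> \<theta> > 0 \<longrightarrow> \<theta> < threshold C n p k \<longrightarrow>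
       (INF \<psi> \<in> tests n p.
          max (P_event (iid n (P0 p)) (\<lambda>X. \<psi> X = 1))
              (SUP v \<in> B0 p k. P_event (iid n (Pv p \<theta> v)) (\<lambda>X. \<psi> X = 0)))
       \<ge> 1 / 2 - \<nu>)"
proof -
  define K where "K = max (1 + 8 * \<nu>\<^sup>2) (ln (exp 1 / (2 - 4 * \<nu>)))"
  \<comment> \<open>For \<open>\<nu> \<ge> 1 / 2\<close> the claimed bound is at most 0, so any
    positive value serves; 1 is a default.\<close>
  define C where "C = (if \<nu> < 1 / 2 then ln K else 1)"
  have "0 < 8 * \<nu>\<^sup>2" using assms by simp
  then have K1: "K > 1" unfolding K_def by linarith
  then have C: "C > 0" by (simp add: C_def)
  have risk: "1 / 2 - \<nu> \<le> max (P_event (iid n (P0 p)) (\<lambda>X. \<psi> X = 1))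
              (SUP v \<in> B0 p k. P_event (iid n (Pv p \<theta> v)) (\<lambda>X. \<psi> X = 0))"
    if "n > 0" "k > 0" "k \<le> p" "\<theta> > 0" "\<theta> < threshold C n p k" "\<psi> \<in> tests n p"
    for n p k :: nat and \<theta> :: real and \<psi>
  proof (cases "\<nu> < 1 / 2")
    case True
    note * = max_risk_lower_bound[OF that(1-5) C that(6)]
    have eC: "exp C = K" using True K1 by (simp add: C_def)
    show ?thesis
    proof (cases "K \<le> 1 + 8 * \<nu>\<^sup>2")
      case True
      then show ?thesis using *(2) assms eC by simp
    next
      case False
      \<comment> \<open>Here \<open>2 - 4 * \<nu> = exp (- (K - 1)) \<le> 1 / K\<close>, so the
        bound \<open>1 / (4 * K)\<close> suffices; this is the origin of the second entry of the
        maximum.\<close>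
      then have "K = ln (exp 1 / (2 - 4 * \<nu>))" by (simp add: K_def max_def split: if_splits)
      also have "\<dots> = 1 - ln (2 - 4 * \<nu>)" using \<open>\<nu> < 1 / 2\<close> by (simp add: ln_div)
      finally have "2 - 4 * \<nu> = exp (- (K - 1))" using \<open>\<nu> < 1 / 2\<close> by simp
      also have "\<dots> = 1 / exp (K - 1)" by (simp add: exp_diff)
      also have "\<dots> \<le> 1 / K" using exp_ge_add_one_self[of "K - 1"] K1 by (intro divide_left_mono) auto
      finally have "1 / 2 - \<nu> \<le> 1 / (4 * K)" by simp
      then show ?thesis using *(1) eC by simp
    qed
  next
    case False
    have "0 \<le> P_event (iid n (P0 p)) (\<lambda>X. \<psi> X = 1)" by (simp add: P_event_def)
    then show ?thesis using False by simp
  qed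
  \<comment> \<open>The constant test shows that the infimum runs over a nonempty set, as a lower
    bound for a real-valued \<open>INF\<close> requires.\<close>
  have "(\<lambda>_. 0) \<in> tests n p" for n p by (simp add: tests_def)
  then have ne: "tests n p \<noteq> {}" for n p by blast
  show ?thesis
  proof (intro exI[of _ C] conjI C impI allI)
    show "C = ln (max (1 + 8 * \<nu>\<^sup>2) (ln (exp 1 / (2 - 4 * \<nu>))))" if "\<nu> < 1 / 2"
      using that by (simp add: C_def K_def)
  qed (intro cINF_greatest ne risk)
qed

end
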